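(* Let $\mathbf{A}\in\mathbb{C}^{m\times n}$ and $\mathbf{B}\in\mathbb{C}^{s\times n}$, and let $\mathbf{X}_{LS}=(x_{ij})\in\mathbb{C}^{s\times m}$ be the least squares solution with minimum norm of the matrix equation $\mathbf{X}\mathbf{A}=\mathbf{B}$. Put $\check{\mathbf{B}}:=\mathbf{B}\mathbf{A}^{*}\in\mathbb{C}^{s\times m}$ and let $\check{\mathbf{b}}_{i.}$ denote the $i$th row of $\check{\mathbf{B}}$, $i=1,\ldots,s$. (i) If $\operatorname{rank}\mathbf{A}=m$, then for all $i=1,\ldots,s$ and $j=1,\ldots,m$, $$x_{ij}=\frac{\det\left((\mathbf{A}\mathbf{A}^{*})_{j.}(\check{\mathbf{b}}_{i.})\right)}{\det(\mathbf{A}\mathbf{A}^{*})}.$$ (ii) If $\operatorname{rank}\mathbf{A}=r\le n<m$, then for all $i=1,\ldots,s$ and $j=1,\ldots,m$, $$x_{ij}=\frac{\sum_{\alpha\in I_{r,m}\{j\}}\left|\left((\mathbf{A}\mathbf{A}^{*})_{j.}(\check{\mathbf{b}}_{i.})\right)_{\alpha}^{\alpha}\right|}{\sum_{\alpha\in I_{r,m}}\left|(\mathbf{A}\mathbf{A}^{*})_{\alpha}^{\alpha}\right|}.$$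
   Context: $\mathbb{C}^{m\times n}$ is the set of complex $m\times n$ matrices, $\mathbf{A}^{*}$ is the Hermitian adjoint (conjugate transpose) of $\mathbf{A}$, and $\|\cdot\|$ is the Frobenius norm. Least squares solutions of $\mathbf{X}\mathbf{A}=\mathbf{B}$ are the matrices in $S_2=\{\mathbf{X}\in\mathbb{C}^{s\times m}: \|\mathbf{X}\mathbf{A}-\mathbf{B}\|=\min\}$, i.e. the minimizers of $\|\mathbf{X}\mathbf{A}-\mathbf{B}\|$ over $\mathbb{C}^{s\times m}$. The least squares solution with minimum norm, $\mathbf{X}_{LS}$, is the element of $S_2$ of smallest Frobenius norm. For a square matrix $\mathbf{M}$ and a row vector $\mathbf{b}$, $\mathbf{M}_{j.}(\mathbf{b})$ denotes the matrix obtained from $\mathbf{M}$ by replacing its $j$th row with $\mathbf{b}$. For an index set $\alpha$, $|\mathbf{M}_{\alpha}^{\alpha}|$ denotes the principal minor of $\mathbf{M}$ determined by the rows and columns indexed by $\alpha$. For $1\le k\le m$, $I_{k,m}$ is the collection of all strictly increasing sequences of $k$ integers chosen from $\{1,\ldots,m\}$ (viewed as $k$-element subsets), and $I_{k,m}\{j\}:=\{\alpha\in I_{k,m}: j\in\alpha\}$. The rank $r$ is assumed to be at least $1$ so that these index sets are defined. *)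

theory Defs
  imports
    "Jordan_Normal_Form.Schur_Decomposition"
    "Jordan_Normal_Form.DL_Rank"
    "Jordan_Normal_Form.DL_Submatrix"
begin

(* Rows and columns are indexed from 0, as everywhere in Jordan_Normal_Form, so the index
   range {1,...,m} of the mathematical text is {0..<m} here. *)

definition frobenius_norm :: "complex mat \<Rightarrow> real" where
  "frobenius_norm M = sqrt (\<Sum>i<dim_row M. \<Sum>j<dim_col M. (cmod (M $$ (i, j)))\<^sup>2)"

(* The set S_2 of least squares solutions of X A = B. *)
definition lsq_solutions :: "complex mat \<Rightarrow> complex mat \<Rightarrow> complex mat set" where
  "lsq_solutions A B =
    {X \<in> carrier_mat (dim_row B) (dim_row A).
       \<forall>Y \<in> carrier_mat (dim_row B) (dim_row A).
         frobenius_norm (X * A - B) \<le> frobenius_norm (Y * A - B)}"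

definition is_min_norm_lsq_solution :: "complex mat \<Rightarrow> complex mat \<Rightarrow> complex mat \<Rightarrow> bool" where
  "is_min_norm_lsq_solution A B X \<longleftrightarrow>
    X \<in> lsq_solutions A B \<and> (\<forall>Y \<in> lsq_solutions A B. frobenius_norm X \<le> frobenius_norm Y)"

(* M_{j.}(b); the argument order follows replace_col. *)
definition replace_row :: "'a mat \<Rightarrow> 'a vec \<Rightarrow> nat \<Rightarrow> 'a mat" where
  "replace_row M b j =
    mat (dim_row M) (dim_col M) (\<lambda>(i, k). if i = j then b $ k else M $$ (i, k))"

definition principal_minor :: "'a::comm_ring_1 mat \<Rightarrow> nat set \<Rightarrow> 'a" where
  "principal_minor M \<alpha> = det (submatrix M \<alpha> \<alpha>)"

(* I_{k,m}: strictly increasing sequences are represented by their sets of entries. *)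
definition index_sets :: "nat \<Rightarrow> nat \<Rightarrow> nat set set" where
  "index_sets k m = {\<alpha>. \<alpha> \<subseteq> {0..<m} \<and> card \<alpha> = k}"

definition index_sets_containing :: "nat \<Rightarrow> nat \<Rightarrow> nat \<Rightarrow> nat set set" where
  "index_sets_containing k m j = {\<alpha> \<in> index_sets k m. j \<in> \<alpha>}"

end

theory Submission
  imports Defs
begin

text \<open>
  Write \<open>M = A A\<^sup>*\<close>. Every rank factorization \<open>A = F G\<close> gives the minimum norm least squares solution
  explicitly as \<open>X = B G\<^sup>* (G G\<^sup>*)\<inverse> (F\<^sup>* F)\<inverse> F\<^sup>*\<close>, by two applications of Pythagoras, so
  \<open>X M = B A\<^sup>*\<close> and each row \<open>x\<close> of \<open>X\<close> lies in the row space of \<open>F\<^sup>*\<close>. With \<open>c = x M\<close> we have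
  \<open>x (M + t I) = c + t x\<close>, and Cramer's rule yields
  \<open>x\<^sub>j det (M + t I) = det ((M + t I)\<^sub>j\<^sub>.(c)) + t det ((M + t I)\<^sub>j\<^sub>.(x))\<close>. The coefficients of these
  polynomials in \<open>t\<close> are sums of principal minors; in the two on the right only index sets containing
  \<open>j\<close> contribute, because row \<open>j\<close> carries no \<open>t\<close>. At \<open>t\<^bsup>m - r\<^esup>\<close> the last term vanishes, since
  \<open>M\<^sub>j\<^sub>.(x)\<close> factors through dimension \<open>r\<close>, and the sum of the \<open>r\<close>-minors of \<open>M\<close> equals
  \<open>det (G G\<^sup>*) det (F\<^sup>* F) \<noteq> 0\<close>. Part (i) is the case \<open>r = m\<close>.
\<close>

section \<open>Determinants and principal minors\<close>

text \<open>Conjugation by the increasing bijection \<open>pick \<alpha>\<close> carries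
  permutations of \<open>{0..<card \<alpha>}\<close> to permutations of \<alpha> and keeps the sign.
  Without the reindexing of \<open>submatrix\<close>, minors for different \<alpha> refer to one
  ambient index range and can be added up.\<close>

lemma principal_minor_permutes:
  fixes M :: "'a::comm_ring_1 mat"
  assumes M: "M \<in> carrier_mat m m" and \<alpha>: "\<alpha> \<subseteq> {0..<m}"
  shows "principal_minor M \<alpha> =
    (\<Sum>p | p permutes \<alpha>. signof p * (\<Prod>i\<in>\<alpha>. M $$ (i, p i)))"
proof -
  let ?k = "card \<alpha>" and ?f = "pick \<alpha>"
  have fin: "finite \<alpha>" using \<alpha> finite_subset by blast
  have dims: "{i. i < m \<and> i \<in> \<alpha>} = \<alpha>" using \<alpha> by auto
  have sub: "submatrix M \<alpha> \<alpha> = mat ?k ?k (\<lambda>(i, j). M $$ (?f i, ?f j))"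
    using M by (simp add: submatrix_def dims)
  have inj: "inj_on ?f {0..<?k}"
    by (rule inj_onI) (metis atLeastLessThan_iff linorder_neqE_nat order_less_irrefl pick_mono_le)
  have im: "?f ` {0..<?k} = \<alpha>"
    by (rule card_subset_eq) (use fin inj in \<open>auto simp: card_image pick_in_set_le\<close>)
  have bij: "bij_betw ?f {0..<?k} \<alpha>" using inj im by (simp add: bij_betw_def)
  have "principal_minor M \<alpha> =
    (\<Sum>p | p permutes {0..<?k}. signof p * (\<Prod>i = 0..<?k. M $$ (?f i, ?f (p i))))"
    unfolding principal_minor_def sub det_def
    by (auto intro!: sum.cong prod.cong arg_cong2[where f = "(*)"] dest: permutes_in_image)
  also have "\<dots> = (\<Sum>p | p permutes \<alpha>. signof p * (\<Prod>i\<in>\<alpha>. M $$ (i, p i)))"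
  proof (rule sum.reindex_bij_witness[where i = "map_permutation \<alpha> (inv_into {0..<?k} ?f)"
        and j = "map_permutation {0..<?k} ?f"], goal_cases)
    case (1 p)
    then show ?case by (intro map_permutation_compose_inv[OF bij]) (use inj in auto)
  next
    case (2 p)
    then show ?case using map_permutation_permutes[OF bij] by auto
  next
    case (3 p)
    then show ?case
      by (intro map_permutation_compose_inv[OF bij_betw_inv_into[OF bij]])
        (auto simp: im inv_into_into f_inv_into_f)
  next
    case (4 p)
    then show ?case using map_permutation_permutes[OF bij_betw_inv_into[OF bij]] by auto
  next
    case (5 p)
    then have p: "p permutes {0..<?k}" by simp
    have "(\<Prod>i\<in>\<alpha>. M $$ (i, map_permutation {0..<?k} ?f p i)) =
        (\<Prod>i\<in>{0..<?k}. M $$ (?f i, map_permutation {0..<?k} ?f p (?f i)))"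
      by (rule prod.reindex_bij_betw[OF bij, symmetric])
    also have "\<dots> = (\<Prod>i\<in>{0..<?k}. M $$ (?f i, ?f (p i)))"
      by (rule prod.cong) (auto simp: map_permutation_apply[OF inj])
    finally show ?case using sign_map_permutation[OF inj p] by simp
  qed
  finally show ?thesis .
qed

lemma principal_minor_full:
  fixes M :: "'a::comm_ring_1 mat"
  assumes M: "M \<in> carrier_mat m m"
  shows "principal_minor M {0..<m} = det M"
  using M by (simp add: principal_minor_permutes[OF M] det_def')

lemma index_sets_self: "index_sets m m = {{0..<m}}"
  unfolding index_sets_def by (auto dest: card_subset_eq[rotated])

lemma index_sets_eq_empty:
  assumes "m < r"
  shows "index_sets r m = {}"
proof -
  have "card \<alpha> \<le> m" if "\<alpha> \<subseteq> {0..<m}" for \<alpha>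
    using card_mono[of "{0..<m}" \<alpha>] that by simp
  then show ?thesis using assms unfolding index_sets_def by (auto dest: leD)
qed

text \<open>Multilinearity in the rows: \<alpha> collects the rows in which the factor from
  \<open>N\<close> is chosen, the other rows contribute \<open>d i\<close>. An arbitrary
  \<open>d\<close> lets a single row go without a shift later on.\<close>

lemma det_add_mat_diag:
  fixes N :: "'a::comm_ring_1 mat"
  assumes N: "N \<in> carrier_mat m m"
  shows "det (N + mat_diag m d) =
    (\<Sum>\<alpha>\<in>Pow {0..<m}. (\<Prod>i\<in>{0..<m} - \<alpha>. d i) * principal_minor N \<alpha>)"
proof -
  let ?U = "{0..<m}"
  \<comment> \<open>For the product to survive, \<open>p\<close> must fix every index outside
    \<alpha>, and then it already permutes \<alpha>.\<close>
  have diag: "(\<Prod>i\<in>?U - \<alpha>. if p i = i then d i else 0) =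
      (if p permutes \<alpha> then \<Prod>i\<in>?U - \<alpha>. d i else 0)"
    if p: "p permutes ?U" and \<alpha>: "\<alpha> \<subseteq> ?U" for p \<alpha>
  proof (cases "p permutes \<alpha>")
    case True
    then show ?thesis by (auto intro!: prod.cong simp: permutes_not_in)
  next
    case False
    then obtain i where "i \<in> ?U - \<alpha>" "p i \<noteq> i" using permutes_superset[OF p] by blast
    then have "(\<Prod>i\<in>?U - \<alpha>. if p i = i then d i else 0) = 0"
      by (intro prod_zero) auto
    then show ?thesis using False by simp
  qed
  have "det (N + mat_diag m d) = (\<Sum>p | p permutes ?U. signof p *
      (\<Prod>i\<in>?U. N $$ (i, p i) + (if p i = i then d i else 0)))"
    using N by (subst det_def'[of _ m])
      (auto intro!: sum.cong prod.cong arg_cong2[where f = "(*)"]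
        simp: mat_diag_def dest: permutes_in_image)
  also have "\<dots> = (\<Sum>p | p permutes ?U. \<Sum>\<alpha>\<in>Pow ?U. if p permutes \<alpha>
      then (\<Prod>i\<in>?U - \<alpha>. d i) * (signof p * (\<Prod>i\<in>\<alpha>. N $$ (i, p i))) else 0)"
  proof (rule sum.cong[OF refl], goal_cases)
    case (1 p)
    then have p: "p permutes ?U" by simp
    show ?case
      unfolding prod_add[OF finite_atLeastLessThan] sum_distrib_left
      by (rule sum.cong[OF refl]) (use diag[OF p] in \<open>auto simp: ac_simps\<close>)
  qed
  also have "\<dots> = (\<Sum>\<alpha>\<in>Pow ?U. \<Sum>p | p permutes ?U. if p permutes \<alpha>
      then (\<Prod>i\<in>?U - \<alpha>. d i) * (signof p * (\<Prod>i\<in>\<alpha>. N $$ (i, p i))) else 0)"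
    by (rule sum.swap)
  also have "\<dots> = (\<Sum>\<alpha>\<in>Pow ?U. \<Sum>p | p permutes \<alpha>.
      (\<Prod>i\<in>?U - \<alpha>. d i) * (signof p * (\<Prod>i\<in>\<alpha>. N $$ (i, p i))))"
  proof (rule sum.cong[OF refl], goal_cases)
    case (1 \<alpha>)
    then have "{p. p permutes ?U} \<inter> {p. p permutes \<alpha>} = {p. p permutes \<alpha>}"
      using permutes_subset by fastforce
    then show ?case by (simp add: sum.If_cases finite_permutations)
  qed
  also have "\<dots> = (\<Sum>\<alpha>\<in>Pow ?U. (\<Prod>i\<in>?U - \<alpha>. d i) * principal_minor N \<alpha>)"
    by (rule sum.cong[OF refl]) (simp add: principal_minor_permutes[OF N] sum_distrib_left)
  finally show ?thesis .
qed

section \<open>Row replacement and Cramer's rule\<close>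

lemma det_replace_row:
  fixes N :: "'a::comm_ring_1 mat"
  assumes N: "N \<in> carrier_mat m m" and j: "j < m"
  shows "det (replace_row N b j) = (\<Sum>k<m. b $ k * cofactor N j k)"
proof -
  have R: "replace_row N b j \<in> carrier_mat m m" using N by (auto simp: replace_row_def)
  have "mat_delete (replace_row N b j) j k = mat_delete N j k" for k
    by (rule eq_matI) (use N j in \<open>auto simp: mat_delete_def replace_row_def\<close>)
  then show ?thesis
    using N j by (subst laplace_expansion_row[OF R j]) (auto simp: cofactor_def replace_row_def)
qed

text \<open>Cramer's rule for rows, by transposing the column version;
  \<open>N\<^sup>T *\<^sub>v x\<close> stands for the row vector \<open>x N\<close>. Nothing is
  divided by \<open>det N\<close>, so the rule applies to \<open>M + t I\<close> at every
  \<open>t\<close>.\<close>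

lemma det_replace_row_mult:
  fixes N :: "'a::comm_ring_1 mat"
  assumes N: "N \<in> carrier_mat m m" and x: "x \<in> carrier_vec m" and j: "j < m"
  shows "det (replace_row N (N\<^sup>T *\<^sub>v x) j) = x $ j * det N"
proof -
  have "replace_row N (N\<^sup>T *\<^sub>v x) j = (replace_col N\<^sup>T (N\<^sup>T *\<^sub>v x) j)\<^sup>T"
    by (rule eq_matI) (use N in \<open>auto simp: replace_row_def replace_col_def\<close>)
  moreover have "replace_col N\<^sup>T (N\<^sup>T *\<^sub>v x) j \<in> carrier_mat m m"
    using N by (auto simp: replace_col_def)
  ultimately show ?thesis
    using cramer_lemma_mat[of "N\<^sup>T" m x j] N x j by (simp add: det_transpose)
qed

text \<open>Overwriting row \<open>j\<close> erases its diagonal shift as well, hence the shift 0 at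
  \<open>j\<close>.\<close>

lemma replace_row_add_mat_diag:
  fixes N :: "'a::comm_ring_1 mat"
  assumes "N \<in> carrier_mat m m"
  shows "replace_row (N + mat_diag m d) b j = replace_row N b j + mat_diag m (d(j := 0))"
  by (rule eq_matI) (use assms in \<open>auto simp: replace_row_def mat_diag_def\<close>)

text \<open>The new row is a combination of the rows of \<open>Q\<close>, so only the coefficients
  in row \<open>j\<close> of \<open>P\<close> change. The replaced matrix thus still factors through
  dimension \<open>r\<close>.\<close>

lemma replace_row_mult:
  assumes P: "P \<in> carrier_mat m r" and Q: "Q \<in> carrier_mat r n"
    and V: "V \<in> carrier_mat s r" and i: "i < s"
  shows "replace_row (P * Q) (row (V * Q) i) j = replace_row P (row V i) j * Q"
proof (rule eq_matI)
  fix k l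
  assume "k < dim_row (replace_row P (row V i) j * Q)" "l < dim_col (replace_row P (row V i) j * Q)"
  then have "k < m" "l < n" using P Q by (auto simp: replace_row_def)
  then show "replace_row (P * Q) (row (V * Q) i) j $$ (k, l) = (replace_row P (row V i) j * Q) $$ (k, l)"
    using P Q V i by (cases "k = j") (simp_all add: replace_row_def scalar_prod_def)
qed (use P Q in \<open>auto simp: replace_row_def\<close>)

lemma row_mult_transpose:
  fixes X :: "'a::comm_semiring_0 mat"
  assumes X: "X \<in> carrier_mat s m" and M: "M \<in> carrier_mat m n" and i: "i < s"
  shows "row (X * M) i = M\<^sup>T *\<^sub>v row X i"
proof (rule eq_vecI)
  fix k assume "k < dim_vec (M\<^sup>T *\<^sub>v row X i)"
  then have "k < n" using M by simp
  then show "row (X * M) i $ k = (M\<^sup>T *\<^sub>v row X i) $ k"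
    using X M i comm_scalar_prod[of "row X i" m "col M k"] by simp
qed (use X M in auto)

section \<open>Polynomials whose coefficients are sums of principal minors\<close>

definition minor_poly :: "nat \<Rightarrow> 'a::comm_ring_1 mat \<Rightarrow> nat set set \<Rightarrow> 'a poly" where
  "minor_poly m N S = (\<Sum>\<alpha>\<in>S. monom (principal_minor N \<alpha>) (m - card \<alpha>))"

lemma coeff_minor_poly:
  assumes S: "S \<subseteq> Pow {0..<m}" and k: "k \<le> m"
  shows "coeff (minor_poly m N S) (m - k) = (\<Sum>\<alpha>\<in>{\<alpha> \<in> S. card \<alpha> = k}. principal_minor N \<alpha>)"
proof -
  have fin: "finite S" using S finite_subset by fastforce
  \<comment> \<open>Subtraction on naturals is truncated: equal exponents give equal cardinalities
    because \<open>card \<alpha>\<close> and \<open>k\<close> are both at most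
    \<open>m\<close>.\<close>
  have "card \<alpha> \<le> m" if "\<alpha> \<in> S" for \<alpha>
    using card_mono[of "{0..<m}" \<alpha>] that S by auto
  then have "m - card \<alpha> = m - k \<longleftrightarrow> card \<alpha> = k" if "\<alpha> \<in> S" for \<alpha>
    using that k by (metis diff_diff_cancel)
  then show ?thesis
    unfolding minor_poly_def coeff_sum coeff_monom
    by (simp add: sum.inter_filter[OF fin] cong: sum.cong)
qed

text \<open>With the same shift in all rows, the product over the complement of \<alpha> is a power
  of \<open>t\<close>. The polynomial is the characteristic polynomial of
  \<open>- N\<close>.\<close>

lemma poly_minor_poly:
  fixes N :: "'a::comm_ring_1 mat"
  assumes "N \<in> carrier_mat m m"
  shows "poly (minor_poly m N (Pow {0..<m})) t = det (N + mat_diag m (\<lambda>_. t))"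
  unfolding det_add_mat_diag[OF assms] minor_poly_def poly_sum poly_monom
  by (rule sum.cong) (auto simp: card_Diff_subset finite_subset)

text \<open>If \<open>j\<close> is not in \<alpha>, it lies in the complement, and the zero shift at
  \<open>j\<close> kills the product.\<close>

lemma poly_minor_poly_containing:
  fixes N :: "'a::comm_ring_1 mat"
  assumes "N \<in> carrier_mat m m" "j < m"
  shows "poly (minor_poly m N {\<alpha> \<in> Pow {0..<m}. j \<in> \<alpha>}) t =
    det (N + mat_diag m ((\<lambda>_. t)(j := 0)))"
proof -
  have "(\<Prod>i\<in>{0..<m} - \<alpha>. ((\<lambda>_. t)(j := 0)) i) = (if j \<in> \<alpha> then t ^ (m - card \<alpha>) else 0)"
    if "\<alpha> \<subseteq> {0..<m}" for \<alpha>
  proof (cases "j \<in> \<alpha>")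
    case True
    then have "(\<Prod>i\<in>{0..<m} - \<alpha>. ((\<lambda>_. t)(j := 0)) i) = (\<Prod>i\<in>{0..<m} - \<alpha>. t)"
      by (intro prod.cong) auto
    then show ?thesis using True that by (simp add: card_Diff_subset finite_subset)
  next
    case False
    then show ?thesis using assms by (auto intro!: prod_zero)
  qed
  then have "det (N + mat_diag m ((\<lambda>_. t)(j := 0))) =
      (\<Sum>\<alpha>\<in>Pow {0..<m}. if j \<in> \<alpha> then t ^ (m - card \<alpha>) * principal_minor N \<alpha> else 0)"
    unfolding det_add_mat_diag[OF assms(1)] by (intro sum.cong) auto
  then show ?thesis
    unfolding minor_poly_def poly_sum poly_monom
    by (subst sum.inter_filter) (auto intro!: sum.cong)
qed

text \<open>Cramer's rule for \<open>M + t I\<close>, read off at \<open>t ^ (m - r)\<close>; this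
  works for singular \<open>M\<close>, where dividing by \<open>det M\<close> would fail. The term
  with \<open>x\<close> carries an extra factor \<open>t\<close>, so it contributes minors of size
  \<open>Suc r\<close>, which \<open>van\<close> removes.\<close>

lemma row_solution_principal_minors:
  fixes M :: "'a::{field_char_0} mat"
  assumes M: "M \<in> carrier_mat m m" and x: "x \<in> carrier_vec m" and j: "j < m"
    and van: "\<And>\<alpha>. \<alpha> \<in> index_sets_containing (Suc r) m j \<Longrightarrow> principal_minor (replace_row M x j) \<alpha> = 0"
  shows "x $ j * (\<Sum>\<alpha>\<in>index_sets r m. principal_minor M \<alpha>) =
    (\<Sum>\<alpha>\<in>index_sets_containing r m j. principal_minor (replace_row M (M\<^sup>T *\<^sub>v x) j) \<alpha>)"
proof (cases "r \<le> m")
  case False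
  then show ?thesis by (simp add: index_sets_containing_def index_sets_eq_empty)
next
  case r: True
  define c where "c = M\<^sup>T *\<^sub>v x"
  let ?S = "{\<alpha> \<in> Pow {0..<m}. j \<in> \<alpha>}"
  have c: "c \<in> carrier_vec m" using M x by (simp add: c_def)
  have R: "replace_row M b j \<in> carrier_mat m m" for b using M by (auto simp: replace_row_def)
  have "smult (x $ j) (minor_poly m M (Pow {0..<m})) =
      minor_poly m (replace_row M c j) ?S + pCons 0 (minor_poly m (replace_row M x j) ?S)"
  \<comment> \<open>Characteristic zero makes the field infinite, so polynomials with the same
    values everywhere coincide.\<close>
  proof (rule iffD1[OF poly_eq_poly_eq_iff], rule ext)
    fix t :: 'a
    let ?D = "mat_diag m (\<lambda>_. t)"
    have MD: "M + ?D \<in> carrier_mat m m" using M by auto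
    have "(M + ?D)\<^sup>T *\<^sub>v x = c + t \<cdot>\<^sub>v x"
    proof (rule eq_vecI)
      fix i assume i: "i < dim_vec (c + t \<cdot>\<^sub>v x)"
      then have "i < m" using x by simp
      moreover have "(\<Sum>k = 0..<m. (if k = i then t else 0) * x $ k) = t * x $ i"
        using \<open>i < m\<close> by (subst sum.remove[of _ i]) auto
      ultimately show "((M + ?D)\<^sup>T *\<^sub>v x) $ i = (c + t \<cdot>\<^sub>v x) $ i"
        using M x by (simp add: c_def scalar_prod_def mat_diag_def distrib_right sum.distrib)
    qed (use M x in \<open>auto simp: mat_diag_def\<close>)
    then have "x $ j * det (M + ?D) = det (replace_row (M + ?D) (c + t \<cdot>\<^sub>v x) j)"
      using det_replace_row_mult[OF MD x j] by simp
    \<comment> \<open>The cofactors of row \<open>j\<close> do not see that row, so the determinant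
      is linear in the inserted vector.\<close>
    also have "\<dots> = det (replace_row (M + ?D) c j) + t * det (replace_row (M + ?D) x j)"
      using c x by (simp add: det_replace_row[OF MD j] distrib_right sum.distrib sum_distrib_left mult.assoc)
    finally show "poly (smult (x $ j) (minor_poly m M (Pow {0..<m}))) t =
        poly (minor_poly m (replace_row M c j) ?S + pCons 0 (minor_poly m (replace_row M x j) ?S)) t"
      by (simp add: poly_minor_poly[OF M] poly_minor_poly_containing[OF R j]
          replace_row_add_mat_diag[OF M] del: Pow_iff)
  qed
  then have "coeff (smult (x $ j) (minor_poly m M (Pow {0..<m}))) (m - r) =
      coeff (minor_poly m (replace_row M c j) ?S + pCons 0 (minor_poly m (replace_row M x j) ?S)) (m - r)"
    by simp
  moreover have "coeff (pCons 0 (minor_poly m (replace_row M x j) ?S)) (m - r) = 0"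
  \<comment> \<open>For \<open>r = m\<close> this is the constant coefficient of a multiple of
    \<open>t\<close>; otherwise the factor \<open>t\<close> moves the index to
    \<open>m - Suc r\<close>.\<close>
  proof (cases "r = m")
    case False
    with r have "m - r = Suc (m - Suc r)" and "Suc r \<le> m" by auto
    then have "coeff (pCons 0 (minor_poly m (replace_row M x j) ?S)) (m - r) =
        (\<Sum>\<alpha>\<in>{\<alpha> \<in> ?S. card \<alpha> = Suc r}. principal_minor (replace_row M x j) \<alpha>)"
      by (simp add: coeff_minor_poly[of ?S] del: Pow_iff)
    also have "\<dots> = 0"
      by (rule sum.neutral) (use van in \<open>auto simp: index_sets_containing_def index_sets_def\<close>)
    finally show ?thesis .
  qed simp
  moreover have "{\<alpha> \<in> Pow {0..<m}. card \<alpha> = r} = index_sets r m"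
    by (auto simp: index_sets_def)
  moreover have "{\<alpha> \<in> ?S. card \<alpha> = r} = index_sets_containing r m j"
    by (auto simp: index_sets_containing_def index_sets_def)
  ultimately show ?thesis
    using r by (simp add: coeff_minor_poly c_def del: Pow_iff)
qed

section \<open>Minors and determinants of products of rectangular matrices\<close>

lemma principal_minor_mult_eq_0:
  fixes P Q :: "'a::idom mat"
  assumes P: "P \<in> carrier_mat m r" and Q: "Q \<in> carrier_mat r m"
    and \<alpha>: "\<alpha> \<subseteq> {0..<m}" and r: "r < card \<alpha>"
  shows "principal_minor (P * Q) \<alpha> = 0"
proof -
  let ?k = "card \<alpha>" and ?f = "pick \<alpha>"
  have dims: "{i. i < m \<and> i \<in> \<alpha>} = \<alpha>" using \<alpha> by auto
  have f: "?f i < m" if "i < ?k" for i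
    using pick_in_set_le[OF that] \<alpha> by auto
  \<comment> \<open>Pad both factors with zeros to square matrices.\<close>
  define P' where "P' = mat ?k ?k (\<lambda>(i, j). if j < r then P $$ (?f i, j) else 0)"
  define Q' where "Q' = mat ?k ?k (\<lambda>(i, j). if i < r then Q $$ (i, ?f j) else 0)"
  have P': "P' \<in> carrier_mat ?k ?k" and Q': "Q' \<in> carrier_mat ?k ?k"
    by (auto simp: P'_def Q'_def)
  have "submatrix (P * Q) \<alpha> \<alpha> = P' * Q'"
  proof (rule eq_matI)
    fix i j assume "i < dim_row (P' * Q')" "j < dim_col (P' * Q')"
    then have ij: "i < ?k" "j < ?k" by (auto simp: P'_def Q'_def)
    have "(\<Sum>l = 0..<?k. (if l < r then P $$ (?f i, l) else 0) * (if l < r then Q $$ (l, ?f j) else 0))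
      = (\<Sum>l = 0..<r. P $$ (?f i, l) * Q $$ (l, ?f j))"
      by (rule sum.mono_neutral_cong_right) (use r in auto)
    then show "submatrix (P * Q) \<alpha> \<alpha> $$ (i, j) = (P' * Q') $$ (i, j)"
      using ij P Q f by (simp add: submatrix_def dims scalar_prod_def P'_def Q'_def)
  qed (use P Q in \<open>auto simp: submatrix_def dims P'_def Q'_def\<close>)
  \<comment> \<open>Column \<open>r\<close> of \<open>P'\<close> is a padded zero column; it exists
    because \<open>r < card \<alpha>\<close>.\<close>
  moreover have "det P' = 0"
    using r by (subst laplace_expansion_column[OF P', of r]) (auto simp: P'_def)
  ultimately show ?thesis
    by (simp add: principal_minor_def det_mult[OF P' Q'])
qed

lemma mat_diag_const: "mat_diag m (\<lambda>_. t) = t \<cdot>\<^sub>m (1\<^sub>m m :: 'a::comm_ring_1 mat)"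
  by (rule eq_matI) (auto simp: mat_diag_def)

text \<open>Sylvester's determinant identity. The powers of \<open>t\<close> take the place of a
  division, so \<open>t = 0\<close> is allowed and \<open>m\<close> and \<open>r\<close> may come in
  either order.\<close>

lemma det_mult_add_smult_one:
  fixes F K :: "'a::idom mat"
  assumes F: "F \<in> carrier_mat m r" and K: "K \<in> carrier_mat r m"
  shows "t ^ r * det (F * K + t \<cdot>\<^sub>m 1\<^sub>m m) = t ^ m * det (K * F + t \<cdot>\<^sub>m 1\<^sub>m r)"
proof -
  \<comment> \<open>\<open>W L\<close> and \<open>L' W\<close> are block upper triangular, so \<open>det W\<close> can be read off in two ways.\<close>
  define W where "W = four_block_mat (t \<cdot>\<^sub>m 1\<^sub>m m) (- F) K (1\<^sub>m r)"
  define L where "L = four_block_mat (1\<^sub>m m) (0\<^sub>m m r) (- K) (1\<^sub>m r)"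
  define L' where "L' = four_block_mat (1\<^sub>m m) (0\<^sub>m m r) (- K) (t \<cdot>\<^sub>m 1\<^sub>m r)"
  have W: "W \<in> carrier_mat (m + r) (m + r)" and L: "L \<in> carrier_mat (m + r) (m + r)"
    and L': "L' \<in> carrier_mat (m + r) (m + r)"
    unfolding W_def L_def L'_def by (auto intro!: four_block_carrier_mat)
  have "W * L = four_block_mat (t \<cdot>\<^sub>m 1\<^sub>m m * 1\<^sub>m m + - F * - K) (t \<cdot>\<^sub>m 1\<^sub>m m * 0\<^sub>m m r + - F * 1\<^sub>m r)
      (K * 1\<^sub>m m + 1\<^sub>m r * - K) (K * 0\<^sub>m m r + 1\<^sub>m r * 1\<^sub>m r)"
    unfolding W_def L_def by (rule mult_four_block_mat) (use F K in auto)
  also have "\<dots> = four_block_mat (F * K + t \<cdot>\<^sub>m 1\<^sub>m m) (- F) (0\<^sub>m r m) (1\<^sub>m r)"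
    using F K by (intro cong_four_block_mat)
      (auto simp: scalar_prod_def sum_negf intro!: eq_matI)
  finally have "det W * det L = det (F * K + t \<cdot>\<^sub>m 1\<^sub>m m) * det (1\<^sub>m r :: 'a mat)"
    using F K det_four_block_mat_lower_left_zero[of "F * K + t \<cdot>\<^sub>m 1\<^sub>m m" m "- F" r _ "1\<^sub>m r"]
    by (simp flip: det_mult[OF W L])
  moreover have "det L = 1"
    unfolding L_def using K
    by (subst det_four_block_mat_upper_right_zero[of _ m _ r]) auto
  ultimately have 1: "det W = det (F * K + t \<cdot>\<^sub>m 1\<^sub>m m)" by simp
  have "L' * W = four_block_mat (1\<^sub>m m * (t \<cdot>\<^sub>m 1\<^sub>m m) + 0\<^sub>m m r * K) (1\<^sub>m m * - F + 0\<^sub>m m r * 1\<^sub>m r)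
      (- K * (t \<cdot>\<^sub>m 1\<^sub>m m) + t \<cdot>\<^sub>m 1\<^sub>m r * K) (- K * - F + t \<cdot>\<^sub>m 1\<^sub>m r * 1\<^sub>m r)"
    unfolding W_def L'_def by (rule mult_four_block_mat) (use F K in auto)
  also have "\<dots> = four_block_mat (t \<cdot>\<^sub>m 1\<^sub>m m) (- F) (0\<^sub>m r m) (K * F + t \<cdot>\<^sub>m 1\<^sub>m r)"
    using F K mult_smult_distrib[of "- K" r m "1\<^sub>m m" m t] mult_smult_assoc_mat[of "1\<^sub>m r" r r K m t]
    by (intro cong_four_block_mat) (auto simp: scalar_prod_def intro!: eq_matI)
  finally have "det L' * det W = det (t \<cdot>\<^sub>m 1\<^sub>m m :: 'a mat) * det (K * F + t \<cdot>\<^sub>m 1\<^sub>m r)"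
    using F K det_four_block_mat_lower_left_zero[of "t \<cdot>\<^sub>m 1\<^sub>m m" m "- F" r _ "K * F + t \<cdot>\<^sub>m 1\<^sub>m r"]
    by (simp del: det_smult flip: det_mult[OF L' W])
  moreover have "det L' = t ^ r"
    unfolding L'_def using K
    by (subst det_four_block_mat_upper_right_zero[of _ m _ r]) auto
  ultimately show ?thesis using 1 by simp
qed

text \<open>A form of the Cauchy-Binet formula. In Sylvester's identity the coefficient at
  \<open>t ^ m\<close> is the sum of the \<open>r\<close>-minors on one side and the constant term
  \<open>det (K * F)\<close> on the other.\<close>

lemma sum_principal_minors_mult:
  fixes F K :: "'a::field_char_0 mat"
  assumes F: "F \<in> carrier_mat m r" and K: "K \<in> carrier_mat r m"
  shows "(\<Sum>\<alpha>\<in>index_sets r m. principal_minor (F * K) \<alpha>) = det (K * F)"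
proof -
  let ?p = "minor_poly m (F * K) (Pow {0..<m})" and ?q = "minor_poly r (K * F) (Pow {0..<r})"
  have FK: "F * K \<in> carrier_mat m m" and KF: "K * F \<in> carrier_mat r r" using F K by auto
  have "monom 1 r * ?p = monom 1 m * ?q"
    by (rule iffD1[OF poly_eq_poly_eq_iff], rule ext)
      (simp add: poly_minor_poly[OF FK] poly_minor_poly[OF KF] mat_diag_const poly_monom
        det_mult_add_smult_one[OF F K])
  then have "coeff (monom 1 r * ?p) m = coeff (monom 1 m * ?q) m" by simp
  moreover have "coeff (monom 1 m * ?q) m = det (K * F)"
  proof -
    have "{\<alpha> \<in> Pow {0..<r}. card \<alpha> = r} = {{0..<r}}"
      using index_sets_self[of r] by (auto simp: index_sets_def)
    then have "coeff ?q 0 = det (K * F)"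
      using coeff_minor_poly[of "Pow {0..<r}" r r "K * F"] by (simp add: principal_minor_full[OF KF])
    then show ?thesis by (simp add: coeff_monom_mult)
  qed
  moreover have "coeff (monom 1 r * ?p) m = (\<Sum>\<alpha>\<in>index_sets r m. principal_minor (F * K) \<alpha>)"
  proof (cases "r \<le> m")
    case True
    have "{\<alpha> \<in> Pow {0..<m}. card \<alpha> = r} = index_sets r m"
      by (auto simp: index_sets_def)
    with True show ?thesis by (simp add: coeff_monom_mult coeff_minor_poly)
  next
    case False
    then show ?thesis by (simp add: coeff_monom_mult index_sets_eq_empty)
  qed
  ultimately show ?thesis by simp
qed

section \<open>Full rank factorization\<close>

lemma mult_mat_unit_vec:
  fixes A :: "'a::semiring_1 mat"
  assumes "A \<in> carrier_mat m n" "k < n"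
  shows "A *\<^sub>v unit_vec n k = col A k"
  by (rule eq_vecI) (use assms in auto)

text \<open>The columns of \<open>F\<close> are a maximal independent set of columns of
  \<open>A\<close>, and \<open>G\<close> holds the coordinates of all columns of \<open>A\<close> in
  this basis. The right inverse \<open>S\<close> records that \<open>G\<close> has full row
  rank.\<close>

lemma full_rank_factorization:
  fixes A :: "'a::field mat"
  assumes A: "A \<in> carrier_mat m n"
  defines "r \<equiv> vec_space.rank m A"
  obtains F G S where "F \<in> carrier_mat m r" "G \<in> carrier_mat r n" "S \<in> carrier_mat n r"
    "A = F * G" "G * S = 1\<^sub>m r"
    "\<forall>v\<in>carrier_vec r. F *\<^sub>v v = 0\<^sub>v m \<longrightarrow> v = 0\<^sub>v r"
proof -
  interpret vec_space "TYPE('a)" m .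
  let ?C = "set (cols A)"
  have C: "?C \<subseteq> carrier_vec m" using A cols_dim by blast
  obtain U where fU: "finite U" and max: "maximal U (\<lambda>T. T \<subseteq> ?C \<and> lin_indpt T)"
    using maximal_exists_superset[of ?C "\<lambda>T. T \<subseteq> ?C \<and> lin_indpt T" "{}"]
    by (auto simp: lin_dep_def)
  have UC: "U \<subseteq> ?C" and indU: "lin_indpt U" using max by (auto simp: maximal_def)
  have cU: "card U = r" using rank_card_indpt[OF A max] by (simp add: r_def)
  obtain fs where fs: "set fs = U" "distinct fs" using finite_distinct_list[OF fU] by blast
  have len: "length fs = r" using fs cU distinct_card by metis
  define F where "F = mat_of_cols m fs"
  have F: "F \<in> carrier_mat m r" using len by (auto simp: F_def)
  have cF: "cols F = fs" unfolding F_def using fs UC C by (intro cols_mat_of_cols) auto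
  \<comment> \<open>A nonzero kernel vector would be a linear dependence among the columns in
    \<open>U\<close>.\<close>
  have inj: "v = 0\<^sub>v r" if "v \<in> carrier_vec r" "F *\<^sub>v v = 0\<^sub>v m" for v
    using lin_depI[OF F that(1) _ that(2)] indU cF fs by auto
  have ex: "\<exists>g \<in> carrier_vec r. F *\<^sub>v g = c" if c: "c \<in> ?C" for c
  proof -
    have "c \<in> span U"
    proof (cases "c \<in> U")
      case True
      then show ?thesis using span_mem UC C by (meson subset_trans subsetD)
    next
      case False
      then have "lin_dep (insert c U)"
        using max c UC unfolding maximal_def by (metis insertI1 insert_subset subset_insertI)
      then show ?thesis
        using lin_dep_iff_in_span[of U c] indU False c UC C by auto
    qed
    then obtain a where "c = lincomb a U"
      using finite_in_span[OF fU] UC C by blast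
    then have "F *\<^sub>v vec r (\<lambda>i. a (col F i)) = c"
      using mat_mult_eq_lincomb[OF F, of a] cF fs by simp
    then show ?thesis by (intro bexI[of _ "vec r (\<lambda>i. a (col F i))"]) auto
  qed
  have "\<forall>k. \<exists>g. k < n \<longrightarrow> g \<in> carrier_vec r \<and> F *\<^sub>v g = col A k"
    using ex A by (metis carrier_matD(2) cols_length cols_nth nth_mem)
  then obtain g where g: "\<And>k. k < n \<Longrightarrow> g k \<in> carrier_vec r"
    and Fg: "\<And>k. k < n \<Longrightarrow> F *\<^sub>v g k = col A k" by metis
  define G where "G = mat_of_cols r (map g [0..<n])"
  have G: "G \<in> carrier_mat r n" by (auto simp: G_def)
  have cG: "col G k = g k" if "k < n" for k
    unfolding G_def using that g by (subst col_mat_of_cols) auto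
  have AFG: "A = F * G"
  proof (rule mat_col_eqI)
    fix k assume "k < dim_col (F * G)"
    then have "k < n" using G by simp
    then show "col A k = col (F * G) k" using Fg cG col_mult2[OF F G] by simp
  qed (use A F G in auto)
  \<comment> \<open>\<open>l k\<close> is a position in \<open>A\<close> of the \<open>k\<close>th
    column of \<open>F\<close>; \<open>S\<close> will select these positions.\<close>
  have "\<forall>k. \<exists>l. k < r \<longrightarrow> l < n \<and> col A l = col F k"
  proof safe
    fix k
    show "\<exists>l. k < r \<longrightarrow> l < n \<and> col A l = col F k"
    proof (cases "k < r")
      case True
      then have "col F k \<in> ?C" using cF fs len UC F by (metis carrier_matD(2) cols_nth nth_mem subsetD)
      then show ?thesis using A by (metis carrier_matD(2) cols_length cols_nth in_set_conv_nth)
    qed simp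
  qed
  then obtain l where l: "\<And>k. k < r \<Longrightarrow> l k < n" and Al: "\<And>k. k < r \<Longrightarrow> col A (l k) = col F k"
    by metis
  define S where "S = mat_of_cols n (map (\<lambda>k. unit_vec n (l k)) [0..<r] :: 'a vec list)"
  have S: "S \<in> carrier_mat n r" by (auto simp: S_def)
  have GS: "G * S = 1\<^sub>m r"
  proof (rule mat_col_eqI)
    fix k assume "k < dim_col (1\<^sub>m r :: 'a mat)"
    then have k: "k < r" by simp
    have "col S k = unit_vec n (l k)" using k by (simp add: S_def)
    then have c: "col (G * S) k = g (l k)"
      using col_mult2[OF G S k] l[OF k] G cG by (simp add: mult_mat_unit_vec)
    \<comment> \<open>Both \<open>g (l k)\<close> and the unit vector are coordinates of column
      \<open>k\<close> of \<open>F\<close>, and coordinates are unique by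
      \<open>inj\<close>.\<close>
    have "F *\<^sub>v (g (l k) - unit_vec r k) = 0\<^sub>v m"
      using F Fg[OF l[OF k]] Al[OF k] g[OF l[OF k]] k
      by (simp add: mult_minus_distrib_mat_vec[OF F] mult_mat_unit_vec)
    then have "g (l k) - unit_vec r k = 0\<^sub>v r" using g[OF l[OF k]] by (intro inj) auto
    then have "g (l k) = unit_vec r k"
      using g[OF l[OF k]] by (metis minus_cancel_vec carrier_vecD eq_iff_diff_eq_0 index_minus_vec(1)
          eq_vecI index_unit_vec(3) index_zero_vec(1))
    then show "col (G * S) k = col (1\<^sub>m r) k" using c k by simp
  qed (use G S in auto)
  show thesis by (rule that[OF F G S AFG GS]) (use inj in auto)
qed

section \<open>Adjoints and the Frobenius norm\<close>

lemma mat_adjoint_eq: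
  "mat_adjoint A = mat (dim_col A) (dim_row A) (\<lambda>(i, j). conjugate (A $$ (j, i)))"
  by (rule eq_matI) (auto simp: mat_adjoint_def mat_of_rows_index)

lemma mat_adjoint_carrier [simp, intro]:
  "A \<in> carrier_mat m n \<Longrightarrow> mat_adjoint A \<in> carrier_mat n m"
  by (auto simp: mat_adjoint_eq)

lemma mat_adjoint_adjoint [simp]:
  "mat_adjoint (mat_adjoint A) = A"
  by (rule eq_matI) (auto simp: mat_adjoint_eq)

lemma mat_adjoint_mult:
  assumes "A \<in> carrier_mat m n" "B \<in> carrier_mat n k"
  shows "mat_adjoint (A * B) = mat_adjoint B * mat_adjoint (A :: complex mat)"
  by (rule eq_matI) (use assms in \<open>auto simp: mat_adjoint_eq scalar_prod_def mult.commute\<close>)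

lemma mat_adjoint_one [simp]: "mat_adjoint (1\<^sub>m n) = (1\<^sub>m n :: complex mat)"
  by (rule eq_matI) (auto simp: mat_adjoint_eq)

lemma frobenius_norm_sq:
  "(frobenius_norm M)\<^sup>2 = (\<Sum>i<dim_row M. \<Sum>j<dim_col M. (cmod (M $$ (i, j)))\<^sup>2)"
  unfolding frobenius_norm_def by (simp add: sum_nonneg)

lemma frobenius_norm_eq_0_iff: "frobenius_norm M = 0 \<longleftrightarrow> M = 0\<^sub>m (dim_row M) (dim_col M)"
proof
  assume "frobenius_norm M = 0"
  then have "(\<Sum>i<dim_row M. \<Sum>j<dim_col M. (cmod (M $$ (i, j)))\<^sup>2) = 0"
    by (simp flip: frobenius_norm_sq)
  then have "\<forall>i<dim_row M. \<forall>j<dim_col M. M $$ (i, j) = 0"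
    by (subst (asm) sum_nonneg_eq_0_iff) (auto intro: sum_nonneg simp: sum_nonneg_eq_0_iff)
  then show "M = 0\<^sub>m (dim_row M) (dim_col M)" by (intro eq_matI) auto
next
  assume "M = 0\<^sub>m (dim_row M) (dim_col M)"
  then have "M $$ (i, j) = 0" if "i < dim_row M" "j < dim_col M" for i j
    using that by (metis index_zero_mat(1))
  then show "frobenius_norm M = 0" by (simp add: frobenius_norm_def)
qed

text \<open>Pythagoras row by row: the diagonal entries of \<open>P * mat_adjoint N\<close> are the
  inner products of corresponding rows, and their real parts are the cross terms.\<close>

lemma frobenius_norm_add_sq:
  assumes P: "P \<in> carrier_mat s m" and N: "N \<in> carrier_mat s m"
    and orth: "P * mat_adjoint N = 0\<^sub>m s s"
  shows "(frobenius_norm (P + N))\<^sup>2 = (frobenius_norm P)\<^sup>2 + (frobenius_norm N)\<^sup>2"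
proof -
  have row: "(\<Sum>j<m. Re (P $$ (i, j) * cnj (N $$ (i, j)))) = 0" if i: "i < s" for i
  proof -
    have "(\<Sum>j = 0..<m. P $$ (i, j) * cnj (N $$ (i, j))) = (P * mat_adjoint N) $$ (i, i)"
      using i P N by (simp add: scalar_prod_def mat_adjoint_eq)
    then have "Re (\<Sum>j<m. P $$ (i, j) * cnj (N $$ (i, j))) = 0"
      using i orth by (simp add: atLeast0LessThan)
    then show ?thesis unfolding Re_sum .
  qed
  have sq: "(cmod (a + b))\<^sup>2 = (cmod a)\<^sup>2 + (cmod b)\<^sup>2 + 2 * Re (a * cnj b)" for a b
    unfolding cmod_power2 by (simp add: power2_eq_square algebra_simps)
  have "(frobenius_norm (P + N))\<^sup>2 = (\<Sum>i<s. (\<Sum>j<m. (cmod (P $$ (i, j)))\<^sup>2) +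
      (\<Sum>j<m. (cmod (N $$ (i, j)))\<^sup>2) + 2 * (\<Sum>j<m. Re (P $$ (i, j) * cnj (N $$ (i, j)))))"
    using P N by (simp add: frobenius_norm_sq sq sum.distrib sum_distrib_left del: times_complex.sel)
  also have "\<dots> = (\<Sum>i<s. (\<Sum>j<m. (cmod (P $$ (i, j)))\<^sup>2) + (\<Sum>j<m. (cmod (N $$ (i, j)))\<^sup>2))"
    by (rule sum.cong) (simp_all add: row del: times_complex.sel)
  also have "\<dots> = (frobenius_norm P)\<^sup>2 + (frobenius_norm N)\<^sup>2"
    using P N by (simp add: frobenius_norm_sq sum.distrib)
  finally show ?thesis .
qed

text \<open>For \<open>v\<close> in the kernel of the Gram matrix, the squared length of
  \<open>w = F v\<close> equals the inner product of \<open>v\<close> with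
  \<open>mat_adjoint F *\<^sub>v w\<close>, which is zero; so \<open>F v = 0\<close>.\<close>

lemma det_adjoint_mult_self_ne_0:
  fixes F :: "complex mat"
  assumes F: "F \<in> carrier_mat m r"
    and inj: "\<And>v. v \<in> carrier_vec r \<Longrightarrow> F *\<^sub>v v = 0\<^sub>v m \<Longrightarrow> v = 0\<^sub>v r"
  shows "det (mat_adjoint F * F) \<noteq> 0"
proof
  assume "det (mat_adjoint F * F) = 0"
  then obtain v where v: "v \<in> carrier_vec r" "v \<noteq> 0\<^sub>v r"
    and 0: "(mat_adjoint F * F) *\<^sub>v v = 0\<^sub>v r"
    using det_0_iff_vec_prod_zero[OF mult_carrier_mat[OF mat_adjoint_carrier[OF F] F]] by blast
  define w where "w = F *\<^sub>v v"
  have w: "w \<in> carrier_vec m" unfolding w_def by (rule mult_mat_vec_carrier[OF F v(1)])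
  have Fw: "mat_adjoint F *\<^sub>v w = 0\<^sub>v r"
    using 0 F v by (simp add: w_def assoc_mult_mat_vec[of _ r m _ r])
  have "conjugate w \<bullet> w = (\<Sum>i = 0..<m. \<Sum>k = 0..<r. cnj (F $$ (i, k)) * cnj (v $ k) * w $ i)"
    using F v w by (simp add: scalar_prod_def w_def sum_distrib_right)
  also have "\<dots> = (\<Sum>k = 0..<r. cnj (v $ k) * (\<Sum>i = 0..<m. cnj (F $$ (i, k)) * w $ i))"
    by (subst sum.swap) (simp add: sum_distrib_left ac_simps)
  also have "\<dots> = (\<Sum>k = 0..<r. cnj (v $ k) * (mat_adjoint F *\<^sub>v w) $ k)"
    using F w by (intro sum.cong) (simp_all add: scalar_prod_def mat_adjoint_eq)
  also have "\<dots> = 0" unfolding Fw by simp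
  finally have "w \<bullet>c w = 0" using comm_scalar_prod[of "conjugate w" m w] w by simp
  then have "w = 0\<^sub>v m" using w by simp
  then show False using inj v by (simp add: w_def)
qed

lemma det_ne_0_inverse:
  fixes H :: "'a::field mat"
  assumes H: "H \<in> carrier_mat r r" and "det H \<noteq> 0"
  obtains H' where "H' \<in> carrier_mat r r" "H * H' = 1\<^sub>m r" "H' * H = 1\<^sub>m r"
  using det_non_zero_imp_unit[OF assms, of "()"] unfolding Units_def ring_mat_simps by auto

section \<open>Least squares solutions\<close>

text \<open>The candidate \<open>X0\<close> inverts the two full rank factors separately. Its
  residual \<open>E\<close> is orthogonal to \<open>D * A\<close> for \<open>D = X - X0\<close>, so
  minimality of the residual of \<open>X\<close> forces \<open>D * A = 0\<close>. Then
  \<open>X0\<close> is a least squares solution too and is orthogonal to \<open>D\<close>, so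
  minimality of the norm forces \<open>D = 0\<close>.\<close>

lemma min_norm_lsq_solution_explicit:
  fixes A B X :: "complex mat"
  assumes A: "A \<in> carrier_mat m n" and B: "B \<in> carrier_mat s n"
    and X: "is_min_norm_lsq_solution A B X"
    and F: "F \<in> carrier_mat m r"
    and AFG: "A = F * G" and G: "G \<in> carrier_mat r n"
    and H': "H' \<in> carrier_mat r r" "G * mat_adjoint G * H' = 1\<^sub>m r"
    and L': "L' \<in> carrier_mat r r" "L' * (mat_adjoint F * F) = 1\<^sub>m r"
  shows "X * A * mat_adjoint A = B * mat_adjoint A"
    and "X = B * mat_adjoint G * H' * L' * mat_adjoint F"
proof -
  let ?F = "mat_adjoint F" and ?G = "mat_adjoint G" and ?A = "mat_adjoint A"
  have F': "?F \<in> carrier_mat r m" and G': "?G \<in> carrier_mat n r" and A': "?A \<in> carrier_mat n m"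
    using F G A by auto
  define U where "U = B * ?G * H' * L'"
  define X0 where "X0 = U * ?F"
  have BG: "B * ?G \<in> carrier_mat s r" using B G' by simp
  then have BGH: "B * ?G * H' \<in> carrier_mat s r" using H' by simp
  then have U: "U \<in> carrier_mat s r" using L' by (simp add: U_def)
  then have X0: "X0 \<in> carrier_mat s m" using F' by (simp add: X0_def)
  have "X0 * F = U * (?F * F)"
    unfolding X0_def by (rule assoc_mult_mat[OF U F' F])
  also have "\<dots> = B * ?G * H' * (L' * (?F * F))"
    unfolding U_def by (rule assoc_mult_mat[OF BGH L'(1) mult_carrier_mat[OF F' F]])
  finally have X0F: "X0 * F = B * ?G * H'" using L' right_mult_one_mat[OF BGH] by simp
  have X0A: "X0 * A = B * ?G * H' * G"
    unfolding AFG using assoc_mult_mat[OF X0 F G] X0F by simp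
  have Xc: "X \<in> carrier_mat s m" and lsq: "X \<in> lsq_solutions A B"
    and Xmin: "\<And>Y. Y \<in> lsq_solutions A B \<Longrightarrow> frobenius_norm X \<le> frobenius_norm Y"
    and Xle: "\<And>Y. Y \<in> carrier_mat s m \<Longrightarrow>
      frobenius_norm (X * A - B) \<le> frobenius_norm (Y * A - B)"
    using X A B by (auto simp: is_min_norm_lsq_solution_def lsq_solutions_def)
  define D where "D = X - X0"
  have D: "D \<in> carrier_mat s m" using Xc X0 by (auto simp: D_def)
  have XD: "X = X0 + D" by (rule eq_matI) (use Xc X0 in \<open>auto simp: D_def\<close>)
  define E where "E = X0 * A - B"
  have E: "E \<in> carrier_mat s n" unfolding E_def by (rule minus_carrier_mat[OF B])
  \<comment> \<open>This makes the rows of the residual \<open>E\<close> orthogonal to the rows of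
    \<open>G\<close>, and hence to those of \<open>A = F * G\<close>.\<close>
  have "X0 * A * ?G = B * ?G"
  proof -
    have "X0 * A * ?G = B * ?G * H' * (G * ?G)"
      unfolding X0A by (rule assoc_mult_mat[OF BGH G G'])
    also have "\<dots> = B * ?G * (H' * (G * ?G))"
      by (rule assoc_mult_mat[OF BG H'(1) mult_carrier_mat[OF G G']])
    also have "H' * (G * ?G) = 1\<^sub>m r"
      using mat_mult_left_right_inverse[OF mult_carrier_mat[OF G G'] H'] .
    finally show ?thesis unfolding right_mult_one_mat[OF BG] .
  qed
  then have "E * ?G = 0\<^sub>m s r"
    unfolding E_def using X0 A B G'
    by (subst minus_mult_distrib_mat[of _ s n]) auto
  moreover have A'eq: "?A = ?G * ?F" unfolding AFG by (rule mat_adjoint_mult[OF F G])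
  ultimately have EA: "E * ?A = 0\<^sub>m s m"
    using assoc_mult_mat[OF E G' F'] F' by simp
  have DA: "D * A \<in> carrier_mat s n" using D A by simp
  have "E * mat_adjoint (D * A) = E * ?A * mat_adjoint D"
    unfolding mat_adjoint_mult[OF D A]
    by (rule assoc_mult_mat[OF E A', symmetric]) (use D in auto)
  then have orth1: "E * mat_adjoint (D * A) = 0\<^sub>m s s"
    unfolding EA using D by (simp add: left_mult_zero_mat[of _ m s])
  have "X * A - B = E + D * A"
  proof -
    have "P + Q - B = P - B + Q" if "P \<in> carrier_mat s n" "Q \<in> carrier_mat s n" for P Q
      by (rule eq_matI) (use that B in auto)
    then show ?thesis
      unfolding XD E_def add_mult_distrib_mat[OF X0 D A]
      using mult_carrier_mat[OF X0 A] DA by blast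
  qed
  then have "(frobenius_norm (X * A - B))\<^sup>2 = (frobenius_norm E)\<^sup>2 + (frobenius_norm (D * A))\<^sup>2"
    using frobenius_norm_add_sq[OF E DA orth1] by simp
  moreover have "(frobenius_norm (X * A - B))\<^sup>2 \<le> (frobenius_norm E)\<^sup>2"
    unfolding E_def using Xle[OF X0] by (simp add: power_mono frobenius_norm_def sum_nonneg)
  ultimately have "frobenius_norm (D * A) = 0" by simp
  then have DA0: "D * A = 0\<^sub>m s n" using frobenius_norm_eq_0_iff carrier_matD[OF DA] by metis
  have XA: "X * A = X0 * A"
    unfolding XD add_mult_distrib_mat[OF X0 D A] DA0 using X0 A by simp
  then have X0lsq: "X0 \<in> lsq_solutions A B"
    using lsq X0 A B by (simp add: lsq_solutions_def)
  \<comment> \<open>\<open>D * F * G = 0\<close>, and \<open>G\<close> cancels because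
    \<open>?G * H'\<close> is its right inverse.\<close>
  have "D * F = D * F * (G * ?G * H')" using H' D F by simp
  also have "\<dots> = D * F * (G * (?G * H'))" using assoc_mult_mat[OF G G' H'(1)] by simp
  also have "\<dots> = D * F * G * (?G * H')"
    by (rule assoc_mult_mat[OF mult_carrier_mat[OF D F] G mult_carrier_mat[OF G' H'(1)], symmetric])
  also have "D * F * G = 0\<^sub>m s n" using DA0 assoc_mult_mat[OF D F G] by (simp add: AFG)
  finally have DF: "D * F = 0\<^sub>m s r"
    by (simp add: left_mult_zero_mat[OF mult_carrier_mat[OF G' H'(1)]])
  \<comment> \<open>The rows of \<open>X0\<close> lie in the row space of \<open>?F\<close>, to
    which \<open>D * F = 0\<close> makes the rows of \<open>D\<close> orthogonal.\<close>
  have "mat_adjoint X0 = F * mat_adjoint U"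
    unfolding X0_def using mat_adjoint_mult[OF U F'] by simp
  then have "D * mat_adjoint X0 = D * F * mat_adjoint U"
    using assoc_mult_mat[OF D F mat_adjoint_carrier[OF U]] by simp
  then have "D * mat_adjoint X0 = 0\<^sub>m s s"
    unfolding DF using U by (simp add: left_mult_zero_mat[of _ r s])
  from frobenius_norm_add_sq[OF D X0 this]
  have "(frobenius_norm X)\<^sup>2 = (frobenius_norm D)\<^sup>2 + (frobenius_norm X0)\<^sup>2"
    unfolding XD using comm_add_mat[OF X0 D] by simp
  moreover have "(frobenius_norm X)\<^sup>2 \<le> (frobenius_norm X0)\<^sup>2"
    using Xmin[OF X0lsq] by (simp add: power_mono frobenius_norm_def sum_nonneg)
  ultimately have "frobenius_norm D = 0" by simp
  then have "D = 0\<^sub>m s m" using frobenius_norm_eq_0_iff carrier_matD[OF D] by metis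
  then have "X = X0" using XD X0 by simp
  then show "X = B * ?G * H' * L' * ?F" by (simp add: X0_def U_def)
  have "X0 * A = E + B" by (rule eq_matI) (use B X0 A in \<open>auto simp: E_def\<close>)
  then show "X * A * ?A = B * ?A"
    unfolding XA using EA B A' by (simp add: add_mult_distrib_mat[OF E B A'])
qed

text \<open>One formula for every rank, of which both parts of the theorem are instances. Splitting
  \<open>A * mat_adjoint A\<close> as \<open>F * (H * ?F)\<close> yields the nonzero denominator,
  splitting it as \<open>(F * H) * ?F\<close> the vanishing of the larger minors.\<close>

lemma min_norm_lsq_solution_minors:
  fixes A B X :: "complex mat"
  assumes A: "A \<in> carrier_mat m n" and B: "B \<in> carrier_mat s n"
    and X: "is_min_norm_lsq_solution A B X"
    and r: "r = vec_space.rank m A" and i: "i < s" and j: "j < m"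
  shows "X $$ (i, j) =
    (\<Sum>\<alpha>\<in>index_sets_containing r m j.
       principal_minor (replace_row (A * mat_adjoint A) (row (B * mat_adjoint A) i) j) \<alpha>)
      / (\<Sum>\<alpha>\<in>index_sets r m. principal_minor (A * mat_adjoint A) \<alpha>)"
proof -
  obtain F G S where F: "F \<in> carrier_mat m r" and G: "G \<in> carrier_mat r n"
    and S: "S \<in> carrier_mat n r" and AFG: "A = F * G" and GS: "G * S = 1\<^sub>m r"
    and injF: "\<forall>v\<in>carrier_vec r. F *\<^sub>v v = 0\<^sub>v m \<longrightarrow> v = 0\<^sub>v r"
    using full_rank_factorization[OF A] unfolding r .
  let ?F = "mat_adjoint F" and ?G = "mat_adjoint G" and ?A = "mat_adjoint A"
  let ?M = "A * ?A"
  have F': "?F \<in> carrier_mat r m" and G': "?G \<in> carrier_mat n r" and A': "?A \<in> carrier_mat n m"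
    and S': "mat_adjoint S \<in> carrier_mat r n"
    using F G A S by auto
  have M: "?M \<in> carrier_mat m m" using A A' by simp
  define H where "H = G * ?G"
  have H: "H \<in> carrier_mat r r" using G G' by (simp add: H_def)
  \<comment> \<open>Taking adjoints in \<open>G * S = 1\<^sub>m r\<close> gives a left inverse of
    \<open>?G\<close>.\<close>
  have injG: "v = 0\<^sub>v r" if v: "v \<in> carrier_vec r" and Gv: "?G *\<^sub>v v = 0\<^sub>v n" for v
  proof -
    have "v = mat_adjoint S * ?G *\<^sub>v v"
      using v by (simp flip: mat_adjoint_mult[OF G S] add: GS)
    also have "\<dots> = 0\<^sub>v r" using assoc_mult_mat_vec[OF S' G' v] Gv S'
      by (auto simp: scalar_prod_def intro!: eq_vecI)
    finally show ?thesis .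
  qed
  have detH: "det H \<noteq> 0"
    using det_adjoint_mult_self_ne_0[OF G' injG] by (simp add: H_def)
  have detL: "det (?F * F) \<noteq> 0"
    using det_adjoint_mult_self_ne_0[OF F] injF by blast
  obtain H' where H': "H' \<in> carrier_mat r r" "H * H' = 1\<^sub>m r"
    using det_ne_0_inverse[OF H detH] .
  obtain L' where L': "L' \<in> carrier_mat r r" "L' * (?F * F) = 1\<^sub>m r"
    using det_ne_0_inverse[OF mult_carrier_mat[OF F' F] detL] .
  define U where "U = B * ?G * H' * L'"
  have U: "U \<in> carrier_mat s r" unfolding U_def
    by (rule mult_carrier_mat[OF mult_carrier_mat[OF mult_carrier_mat[OF B G'] H'(1)] L'(1)])
  note sol = min_norm_lsq_solution_explicit[OF A B X F AFG G H'(1) H'(2)[unfolded H_def] L']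
  have XU: "X = U * ?F" using sol(2) by (simp add: U_def)
  have Xc: "X \<in> carrier_mat s m" using XU U F' by simp
  have "?A = ?G * ?F" unfolding AFG by (rule mat_adjoint_mult[OF F G])
  then have "?M = F * (G * (?G * ?F))"
    using assoc_mult_mat[OF F G mult_carrier_mat[OF G' F']] by (simp add: AFG)
  also have "\<dots> = F * (H * ?F)"
    using assoc_mult_mat[OF G G' F'] by (simp add: H_def)
  finally have MF: "?M = F * (H * ?F)" .
  have HF: "H * ?F \<in> carrier_mat r m" using H F' by simp
  have "(\<Sum>\<alpha>\<in>index_sets r m. principal_minor ?M \<alpha>) = det (H * ?F * F)"
    unfolding MF by (rule sum_principal_minors_mult[OF F HF])
  also have "\<dots> = det H * det (?F * F)"
    using det_mult[OF H mult_carrier_mat[OF F' F]] assoc_mult_mat[OF H F' F] by simp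
  finally have ne: "(\<Sum>\<alpha>\<in>index_sets r m. principal_minor ?M \<alpha>) \<noteq> 0"
    using detH detL by simp
  have x: "row X i \<in> carrier_vec m" using Xc by auto
  have c: "?M\<^sup>T *\<^sub>v row X i = row (B * ?A) i"
  proof -
    have "row (B * ?A) i = row (X * ?M) i"
      using sol(1) assoc_mult_mat[OF Xc A A'] by simp
    also have "\<dots> = ?M\<^sup>T *\<^sub>v row X i"
      by (rule row_mult_transpose[OF Xc M i])
    finally show ?thesis ..
  qed
  \<comment> \<open>Row \<open>i\<close> of \<open>X\<close> is row \<open>i\<close> of
    \<open>U\<close> times \<open>?F\<close>, so the replaced matrix keeps the inner dimension
    \<open>r\<close>.\<close>
  have van: "principal_minor (replace_row ?M (row X i) j) \<alpha> = 0"
    if "\<alpha> \<in> index_sets_containing (Suc r) m j" for \<alpha>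
  proof -
    have FH: "F * H \<in> carrier_mat m r" using F H by simp
    let ?P = "replace_row (F * H) (row U i) j"
    have P: "?P \<in> carrier_mat m r" using FH by (simp add: replace_row_def carrier_matD[OF FH] del: index_mult_mat)
    have "?M = F * H * ?F" using assoc_mult_mat[OF F H F'] by (simp add: MF)
    then have "replace_row ?M (row X i) j = ?P * ?F"
      unfolding XU using replace_row_mult[OF FH F' U i] by simp
    then show ?thesis
      using principal_minor_mult_eq_0[OF P F'] that
      by (auto simp: index_sets_containing_def index_sets_def)
  qed
  from row_solution_principal_minors[OF M x j van, of r] c
  have "X $$ (i, j) * (\<Sum>\<alpha>\<in>index_sets r m. principal_minor ?M \<alpha>) =
      (\<Sum>\<alpha>\<in>index_sets_containing r m j. principal_minor (replace_row ?M (row (B * ?A) i) j) \<alpha>)"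
    using Xc i j by simp
  then show ?thesis using ne by (simp add: field_simps)
qed

theorem theorem3p4:
  fixes A B X :: "complex mat" and m n s :: nat
  assumes A: "A \<in> carrier_mat m n"
    and B: "B \<in> carrier_mat s n"
    and X: "is_min_norm_lsq_solution A B X"
  shows
    "(vec_space.rank m A = m \<longrightarrow>
       (\<forall>i<s. \<forall>j<m.
          X $$ (i, j) =
            det (replace_row (A * mat_adjoint A) (row (B * mat_adjoint A) i) j)
              / det (A * mat_adjoint A)))
     \<and>
     (\<forall>r. 1 \<le> r \<and> vec_space.rank m A = r \<and> r \<le> n \<and> n < m \<longrightarrow>
       (\<forall>i<s. \<forall>j<m.
          X $$ (i, j) =
            (\<Sum>\<alpha>\<in>index_sets_containing r m j.
               principal_minor
                 (replace_row (A * mat_adjoint A) (row (B * mat_adjoint A) i) j) \<alpha>)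
              / (\<Sum>\<alpha>\<in>index_sets r m. principal_minor (A * mat_adjoint A) \<alpha>)))"
proof (intro conjI impI allI)
  fix i j assume rank: "vec_space.rank m A = m" and i: "i < s" and j: "j < m"
  have M: "A * mat_adjoint A \<in> carrier_mat m m"
    using A by (intro mult_carrier_mat[of _ m n]) auto
  then have R: "replace_row (A * mat_adjoint A) b j \<in> carrier_mat m m" for b
    by (simp add: replace_row_def carrier_matD[OF M] del: index_mult_mat)
  \<comment> \<open>At full row rank the only index set is \<open>{0..<m}\<close>, so both sums
    collapse to determinants.\<close>
  have "index_sets_containing m m j = {{0..<m}}"
    using j by (auto simp: index_sets_containing_def index_sets_self)
  then show "X $$ (i, j) = det (replace_row (A * mat_adjoint A) (row (B * mat_adjoint A) i) j)
      / det (A * mat_adjoint A)"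
    using min_norm_lsq_solution_minors[OF A B X rank[symmetric] i j]
    by (simp add: index_sets_self principal_minor_full[OF M] principal_minor_full[OF R])
qed (use min_norm_lsq_solution_minors[OF A B X] in blast)

end
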